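(* Neither of the following two statements, (a) and (b), which carry no co-primeness condition on the symbols, holds in general; that is, for each of them there exist a field $K$ and operators over it for which it fails. (a) For all homogeneous degree-one polynomials $S_1,S_2\in K[X,Y]$ and every third-order operator $L\in K[D_x,D_y]$: $L$ has a first-order left factor with symbol $S_1$ and a first-order right factor with symbol $S_2$ if and only if $L$ has a factorization of the type $(S_1)(T)(S_2)$ with $T=\mathrm{Sym}(L)/(S_1S_2)$. (b) For all first-order operators $F_1,F_2\in K[D_x,D_y]$ and every third-order operator $L\in K[D_x,D_y]$: $F_1$ is a left factor of $L$ and $F_2$ is a right factor of $L$ if and only if $L=F_1\circ T\circ F_2$ for some $T\in K[D_x,D_y]$.
   Context: $K$ is a field of characteristic zero with commuting derivations $\partial_x,\partial_y$, assumed differentially closed (it contains solutions of the, possibly non-linear, differential equations with coefficients in $K$ that are needed); its elements are thought of as functions of $x,y$. $K[D_x,D_y]$ is the ring of (bivariate) linear partial differential operators over $K$: $D_x,D_y$ commute with each other, and $D_i a = aD_i+\partial_i(a)$ for $a\in K$, $i \in \{x,y\}$. Multiplication (composition) is denoted $\circ$. For $L=\sum_{i+j\le d}a_{ij}D_x^iD_y^j$ of order $d$, its (principal) symbol is $\mathrm{Sym}(L)=\sum_{i+j=d}a_{ij}X^iY^j\in K[X,Y]$. An operator $F$ is a left (respectively right) factor of $L$ if $L=F\circ G$ (respectively $L=G\circ F$) for some $G\in K[D_x,D_y]$. A factorization of $L$ of the type $(S_1)\dots(S_k)$, where $\mathrm{Sym}(L)=S_1\cdots S_k$, is a factorization $L=F_1\circ\dots\circ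 F_k$ with $\mathrm{Sym}(F_i)=S_i$ for all $i$; if $S_1S_2$ does not divide $\mathrm{Sym}(L)$ then $L$ has no factorization of the type $(S_1)(T)(S_2)$. The statements (a) and (b) are known to be valid when the additional condition $\gcd(S_1,S_2)=1$, respectively $\gcd(\mathrm{Sym}(F_1),\mathrm{Sym}(F_2))=1$, is imposed; the proposition says that this condition cannot be omitted. *)

theory Defs
  imports "HOL-Algebra.UnivPoly"
begin

record 'a diff_ring = "'a ring" +
  pdx :: "'a \<Rightarrow> 'a" (\<open>\<partial>x\<index>\<close>)
  pdy :: "'a \<Rightarrow> 'a" (\<open>\<partial>y\<index>\<close>)

definition derivation :: "('a, 'm) ring_scheme \<Rightarrow> ('a \<Rightarrow> 'a) \<Rightarrow> bool"
  where "derivation K d \<longleftrightarrow> d \<in> carrier K \<rightarrow> carrier K \<and>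
    (\<forall>a\<in>carrier K. \<forall>b\<in>carrier K.
       d (a \<oplus>\<^bsub>K\<^esub> b) = d a \<oplus>\<^bsub>K\<^esub> d b \<and>
       d (a \<otimes>\<^bsub>K\<^esub> b) = (d a \<otimes>\<^bsub>K\<^esub> b) \<oplus>\<^bsub>K\<^esub> (a \<otimes>\<^bsub>K\<^esub> d b))"

locale differential_field = field K for K :: "'a diff_ring" (structure) +
  assumes char_zero: "\<And>n::nat. n > 0 \<Longrightarrow> [n] \<cdot> \<one> \<noteq> \<zero>"
    and derivation_x: "derivation K \<partial>x"
    and derivation_y: "derivation K \<partial>y"
    and derivations_commute: "\<And>a. a \<in> carrier K \<Longrightarrow> \<partial>x (\<partial>y a) = \<partial>y (\<partial>x a)"

definition diff_hom :: "'a diff_ring \<Rightarrow> 'b diff_ring \<Rightarrow> ('a \<Rightarrow> 'b) set"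
  where "diff_hom K L = {h \<in> ring_hom K L. \<forall>a\<in>carrier K.
    h (\<partial>x\<^bsub>K\<^esub> a) = \<partial>x\<^bsub>L\<^esub> (h a) \<and> h (\<partial>y\<^bsub>K\<^esub> a) = \<partial>y\<^bsub>L\<^esub> (h a)}"

text \<open>
  Differential polynomials in the indeterminates \<open>Indet 0\<close>, \<open>Indet 1\<close>, etc., given as
  expressions; two expressions may denote the same differential polynomial. The set of the
  coefficients occurring in \<open>p\<close> is \<open>set_diff_poly p\<close>.
\<close>

datatype 'a diff_poly =
    Coeff 'a
  | Indet nat
  | Plus "'a diff_poly" "'a diff_poly"
  | Times "'a diff_poly" "'a diff_poly"
  | Der_x "'a diff_poly"
  | Der_y "'a diff_poly"

primrec eval_diff_poly :: "'a diff_ring \<Rightarrow> (nat \<Rightarrow> 'a) \<Rightarrow> 'a diff_poly \<Rightarrow> 'a" where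
  "eval_diff_poly K v (Coeff a) = a"
| "eval_diff_poly K v (Indet n) = v n"
| "eval_diff_poly K v (Plus p q) = eval_diff_poly K v p \<oplus>\<^bsub>K\<^esub> eval_diff_poly K v q"
| "eval_diff_poly K v (Times p q) = eval_diff_poly K v p \<otimes>\<^bsub>K\<^esub> eval_diff_poly K v q"
| "eval_diff_poly K v (Der_x p) = \<partial>x\<^bsub>K\<^esub> (eval_diff_poly K v p)"
| "eval_diff_poly K v (Der_y p) = \<partial>y\<^bsub>K\<^esub> (eval_diff_poly K v p)"

definition solvable :: "'a diff_ring \<Rightarrow> 'a diff_poly set \<Rightarrow> bool"
  where "solvable K E \<longleftrightarrow>
    (\<exists>v \<in> UNIV \<rightarrow> carrier K. \<forall>p\<in>E. eval_diff_poly K v p = \<zero>\<^bsub>K\<^esub>)"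

text \<open>
  A differential field \<open>K\<close> is differentially closed if every finite system of (non-linear, partial)
  differential polynomial equations over \<open>K\<close> that has a solution in some differential extension
  field \<open>h : K \<rightarrow> L\<close> already has one in \<open>K\<close>. Inequations \<open>p \<noteq> 0\<close> are covered by the equations
  \<open>p z = 1\<close>. It is no restriction that the elements of \<open>L\<close> have the same type as those of \<open>K\<close>: this
  type is infinite, so it has room for a copy of the differential subfield generated
  by the image of \<open>K\<close> and a solution.
\<close>

definition differentially_closed :: "'a diff_ring \<Rightarrow> bool"
  where "differentially_closed K \<longleftrightarrow> differential_field K \<and>
    (\<forall>E. finite E \<and> (\<forall>p\<in>E. set_diff_poly p \<subseteq> carrier K) \<and>
         (\<exists>(L :: 'a diff_ring) h. differential_field L \<and> h \<in> diff_hom K L \<and>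
            solvable L (map_diff_poly h ` E))
       \<longrightarrow> solvable K E)"

text \<open>
  \<open>K[X,Y]\<close> is \<open>UP (UP K)\<close>: the element \<open>p\<close> is the polynomial with the coefficient \<open>p i j\<close> at
  \<open>X\<^sup>i Y\<^sup>j\<close>.
\<close>

abbreviation poly_XY :: "('a, 'm) ring_scheme \<Rightarrow> (nat \<Rightarrow> 'a, nat \<Rightarrow> nat \<Rightarrow> 'a) up_ring"
  where "poly_XY K \<equiv> UP (UP K)"

text \<open>As usual, the zero polynomial has no degree and is not homogeneous of degree \<open>d\<close>.\<close>

definition homogeneous :: "('a, 'm) ring_scheme \<Rightarrow> nat \<Rightarrow> (nat \<Rightarrow> nat \<Rightarrow> 'a) \<Rightarrow> bool"
  where "homogeneous K d p \<longleftrightarrow> p \<in> carrier (poly_XY K) \<and> p \<noteq> \<zero>\<^bsub>poly_XY K\<^esub> \<and>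
    (\<forall>i j. p i j \<noteq> \<zero>\<^bsub>K\<^esub> \<longrightarrow> i + j = d)"

text \<open>
  An operator is represented by its normal form: \<open>F i j\<close> is the coefficient, written on the left,
  of \<open>D\<^sub>x\<^sup>i D\<^sub>y\<^sup>j\<close>. The next two functions give the normal forms of \<open>D\<^sub>x \<circ> G\<close> and \<open>D\<^sub>y \<circ> G\<close>, by the rule
  \<open>D\<^sub>x \<circ> (g D\<^sub>x\<^sup>i D\<^sub>y\<^sup>j) = g D\<^sub>x\<^bsup>i+1\<^esup> D\<^sub>y\<^sup>j + \<partial>\<^sub>x(g) D\<^sub>x\<^sup>i D\<^sub>y\<^sup>j\<close> and its analogue for \<open>D\<^sub>y\<close>.
\<close>

definition Dx_comp :: "'a diff_ring \<Rightarrow> (nat \<Rightarrow> nat \<Rightarrow> 'a) \<Rightarrow> (nat \<Rightarrow> nat \<Rightarrow> 'a)"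
  where "Dx_comp K G = (\<lambda>i j.
    \<partial>x\<^bsub>K\<^esub> (G i j) \<oplus>\<^bsub>K\<^esub> (if i = 0 then \<zero>\<^bsub>K\<^esub> else G (i - 1) j))"

definition Dy_comp :: "'a diff_ring \<Rightarrow> (nat \<Rightarrow> nat \<Rightarrow> 'a) \<Rightarrow> (nat \<Rightarrow> nat \<Rightarrow> 'a)"
  where "Dy_comp K G = (\<lambda>i j.
    \<partial>y\<^bsub>K\<^esub> (G i j) \<oplus>\<^bsub>K\<^esub> (if j = 0 then \<zero>\<^bsub>K\<^esub> else G i (j - 1)))"

definition lpdo_comp ::
  "'a diff_ring \<Rightarrow> (nat \<Rightarrow> nat \<Rightarrow> 'a) \<Rightarrow> (nat \<Rightarrow> nat \<Rightarrow> 'a) \<Rightarrow> (nat \<Rightarrow> nat \<Rightarrow> 'a)"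
  where "lpdo_comp K F G = (\<lambda>m n.
    \<Oplus>\<^bsub>K\<^esub>z \<in> {(i, j). F i j \<noteq> \<zero>\<^bsub>K\<^esub>}.
      (case z of (i, j) \<Rightarrow> F i j \<otimes>\<^bsub>K\<^esub> (Dx_comp K ^^ i) ((Dy_comp K ^^ j) G) m n))"

text \<open>
  The ring \<open>K[D\<^sub>x,D\<^sub>y]\<close>; its additive group and its unit are, in normal form, those of \<open>K[X,Y]\<close>.
\<close>

definition LPDO :: "'a diff_ring \<Rightarrow> (nat \<Rightarrow> nat \<Rightarrow> 'a) ring"
  where "LPDO K = \<lparr>
    carrier = carrier (poly_XY K),
    mult = lpdo_comp K,
    one = \<one>\<^bsub>poly_XY K\<^esub>,
    zero = \<zero>\<^bsub>poly_XY K\<^esub>,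
    add = add (poly_XY K)\<rparr>"

text \<open>The zero operator gets order \<open>0\<close> and symbol \<open>0\<close>.\<close>

definition lpdo_order :: "'a diff_ring \<Rightarrow> (nat \<Rightarrow> nat \<Rightarrow> 'a) \<Rightarrow> nat"
  where "lpdo_order K L = (LEAST d. \<forall>i j. L i j \<noteq> \<zero>\<^bsub>K\<^esub> \<longrightarrow> i + j \<le> d)"

definition Sym :: "'a diff_ring \<Rightarrow> (nat \<Rightarrow> nat \<Rightarrow> 'a) \<Rightarrow> (nat \<Rightarrow> nat \<Rightarrow> 'a)"
  where "Sym K L = (\<lambda>i j. if i + j = lpdo_order K L then L i j else \<zero>\<^bsub>K\<^esub>)"

definition left_factor ::
  "'a diff_ring \<Rightarrow> (nat \<Rightarrow> nat \<Rightarrow> 'a) \<Rightarrow> (nat \<Rightarrow> nat \<Rightarrow> 'a) \<Rightarrow> bool"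
  where "left_factor K F L \<longleftrightarrow> F \<in> carrier (LPDO K) \<and>
    (\<exists>G \<in> carrier (LPDO K). L = F \<otimes>\<^bsub>LPDO K\<^esub> G)"

definition right_factor ::
  "'a diff_ring \<Rightarrow> (nat \<Rightarrow> nat \<Rightarrow> 'a) \<Rightarrow> (nat \<Rightarrow> nat \<Rightarrow> 'a) \<Rightarrow> bool"
  where "right_factor K F L \<longleftrightarrow> F \<in> carrier (LPDO K) \<and>
    (\<exists>G \<in> carrier (LPDO K). L = G \<otimes>\<^bsub>LPDO K\<^esub> F)"

definition has_factorization_of_type ::
  "'a diff_ring \<Rightarrow> (nat \<Rightarrow> nat \<Rightarrow> 'a) \<Rightarrow> (nat \<Rightarrow> nat \<Rightarrow> 'a) list \<Rightarrow> bool"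
  where "has_factorization_of_type K L Ss \<longleftrightarrow>
    set Ss \<subseteq> carrier (poly_XY K) \<and>
    Sym K L = foldr (mult (poly_XY K)) Ss \<one>\<^bsub>poly_XY K\<^esub> \<and>
    (\<exists>Fs. set Fs \<subseteq> carrier (LPDO K) \<and> map (Sym K) Fs = Ss \<and>
       L = foldr (mult (LPDO K)) Fs \<one>\<^bsub>LPDO K\<^esub>)"

end

theory Submission
  imports Defs "HOL-Algebra.QuotRing" "HOL-Library.Countable"
begin

text \<open>
  Take \<open>L = D\<^sub>x D\<^sub>y\<^sup>2\<close>, \<open>F\<^sub>1 = F\<^sub>2 = D\<^sub>x\<close> and \<open>S\<^sub>1 = S\<^sub>2 = X\<close>, over any differentially closed field.
  Since \<open>L = D\<^sub>x \<circ> D\<^sub>y\<^sup>2 = D\<^sub>y\<^sup>2 \<circ> D\<^sub>x\<close>, the operator \<open>D\<^sub>x\<close> is both a left and a right factor of \<open>L\<close>;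
  but these are two views of one and the same factor, and \<open>L\<close> contains \<open>D\<^sub>x\<close> only once. For (a),
  \<open>X\<^sup>2\<close> does not divide \<open>X Y\<^sup>2 = Sym(L)\<close> (\<open>X_squared_not_dvd\<close>). For (b), if \<open>T \<noteq> 0\<close> has degree \<open>m\<close>
  in \<open>D\<^sub>x\<close>, then \<open>D\<^sub>x \<circ> T \<circ> D\<^sub>x\<close> has degree \<open>m + 2\<close> in \<open>D\<^sub>x\<close>, whereas \<open>L\<close> has degree \<open>1\<close>
  (\<open>not_between_Dx\<close>).

  What takes work is to exhibit a differentially closed field whose elements are natural numbers
  (\<open>differentially_closed_field_exists\<close>). The usual iteration does it, and needs no differential
  algebra: start from the rational numbers with zero derivations and go through all finite
  systems of differential equations, each of them infinitely often. Whenever the current system is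
  solvable in some extension of the current field, replace the field by such an extension. Let
  \<open>K\<^sub>0 \<subseteq> K\<^sub>1 \<subseteq> \<dots>\<close> be the resulting chain and \<open>U\<close> its union. A finite system over \<open>U\<close> has its
  coefficients in some \<open>K\<^sub>m\<close>, and is treated at some later stage \<open>n \<ge> m\<close>. If it has a
  solution in an extension of \<open>U\<close>, then this is also an extension of \<open>K\<^sub>n\<close>, so the system
  acquired a solution in \<open>K\<^bsub>n+1\<^esub> \<subseteq> U\<close>.

  Both ways of building fields that occur here, renaming the elements and taking unions of chains,
  are instances of one principle (\<open>differential_field_directed\<close>): the axioms of a differential
  field involve finitely many elements at a time, so they hold in a structure in which all finite sets
  of elements lie in differential subfields.
\<close>

section \<open>Homomorphisms of differential fields\<close>

instance diff_poly :: (countable) countable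
  by countable_datatype

lemma diff_homI:
  assumes "\<And>a. a \<in> carrier K \<Longrightarrow> h a \<in> carrier L"
    and "\<And>a b. a \<in> carrier K \<Longrightarrow> b \<in> carrier K \<Longrightarrow> h (a \<otimes>\<^bsub>K\<^esub> b) = h a \<otimes>\<^bsub>L\<^esub> h b"
    and "\<And>a b. a \<in> carrier K \<Longrightarrow> b \<in> carrier K \<Longrightarrow> h (a \<oplus>\<^bsub>K\<^esub> b) = h a \<oplus>\<^bsub>L\<^esub> h b"
    and "h \<one>\<^bsub>K\<^esub> = \<one>\<^bsub>L\<^esub>"
    and "\<And>a. a \<in> carrier K \<Longrightarrow> h (\<partial>x\<^bsub>K\<^esub> a) = \<partial>x\<^bsub>L\<^esub> (h a)"
    and "\<And>a. a \<in> carrier K \<Longrightarrow> h (\<partial>y\<^bsub>K\<^esub> a) = \<partial>y\<^bsub>L\<^esub> (h a)"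
  shows "h \<in> diff_hom K L"
  using assms by (simp add: diff_hom_def ring_hom_memI)

lemma diff_homD:
  assumes "h \<in> diff_hom K L"
  shows "h \<in> ring_hom K L"
    and "a \<in> carrier K \<Longrightarrow> h a \<in> carrier L"
    and "a \<in> carrier K \<Longrightarrow> b \<in> carrier K \<Longrightarrow> h (a \<otimes>\<^bsub>K\<^esub> b) = h a \<otimes>\<^bsub>L\<^esub> h b"
    and "a \<in> carrier K \<Longrightarrow> b \<in> carrier K \<Longrightarrow> h (a \<oplus>\<^bsub>K\<^esub> b) = h a \<oplus>\<^bsub>L\<^esub> h b"
    and "h \<one>\<^bsub>K\<^esub> = \<one>\<^bsub>L\<^esub>"
    and "a \<in> carrier K \<Longrightarrow> h (\<partial>x\<^bsub>K\<^esub> a) = \<partial>x\<^bsub>L\<^esub> (h a)"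
    and "a \<in> carrier K \<Longrightarrow> h (\<partial>y\<^bsub>K\<^esub> a) = \<partial>y\<^bsub>L\<^esub> (h a)"
  using assms by (auto simp: diff_hom_def ring_hom_def)

lemma diff_hom_comp:
  assumes "f \<in> diff_hom K L" and "g \<in> diff_hom L M"
  shows "g \<circ> f \<in> diff_hom K M"
  by (rule diff_homI) (simp_all add: diff_homD[OF assms(1)] diff_homD[OF assms(2)])

context differential_field
begin

lemma pdx_closed [simp]: "a \<in> carrier K \<Longrightarrow> \<partial>x a \<in> carrier K"
  and pdy_closed [simp]: "a \<in> carrier K \<Longrightarrow> \<partial>y a \<in> carrier K"
  using derivation_x derivation_y by (auto simp: derivation_def)

lemma pdx_add: "a \<in> carrier K \<Longrightarrow> b \<in> carrier K \<Longrightarrow> \<partial>x (a \<oplus> b) = \<partial>x a \<oplus> \<partial>x b"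
  and pdy_add: "a \<in> carrier K \<Longrightarrow> b \<in> carrier K \<Longrightarrow> \<partial>y (a \<oplus> b) = \<partial>y a \<oplus> \<partial>y b"
  and pdx_mult: "a \<in> carrier K \<Longrightarrow> b \<in> carrier K \<Longrightarrow>
    \<partial>x (a \<otimes> b) = (\<partial>x a \<otimes> b) \<oplus> (a \<otimes> \<partial>x b)"
  and pdy_mult: "a \<in> carrier K \<Longrightarrow> b \<in> carrier K \<Longrightarrow>
    \<partial>y (a \<otimes> b) = (\<partial>y a \<otimes> b) \<oplus> (a \<otimes> \<partial>y b)"
  using derivation_x derivation_y by (auto simp: derivation_def)

lemma pdx_zero [simp]: "\<partial>x \<zero> = \<zero>" and pdy_zero [simp]: "\<partial>y \<zero> = \<zero>"
  using pdx_add[of \<zero> \<zero>] pdy_add[of \<zero> \<zero>] by simp_all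

lemma pdx_one [simp]: "\<partial>x \<one> = \<zero>" and pdy_one [simp]: "\<partial>y \<one> = \<zero>"
  using pdx_mult[of \<one> \<one>] pdy_mult[of \<one> \<one>] by simp_all

end

lemma diff_hom_cong:
  assumes "differential_field K" and "f \<in> diff_hom K L" and "\<And>a. a \<in> carrier K \<Longrightarrow> f a = g a"
  shows "g \<in> diff_hom K L"
proof -
  interpret differential_field K by fact
  show ?thesis
    by (rule diff_homI) (simp_all add: diff_homD[OF assms(2)] flip: assms(3))
qed

lemma diff_hom_zero:
  assumes "differential_field K" and "differential_field L" and "h \<in> diff_hom K L"
  shows "h \<zero>\<^bsub>K\<^esub> = \<zero>\<^bsub>L\<^esub>"
proof -
  interpret K: differential_field K by fact
  interpret L: differential_field L by fact
  show ?thesis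
    using diff_homD(1)[OF assms(3)] K.ring_axioms L.ring_axioms by (rule ring_hom_zero)
qed

lemma diff_hom_inj:
  assumes "differential_field K" and "differential_field L" and "h \<in> diff_hom K L"
  shows "inj_on h (carrier K)"
proof -
  interpret K: differential_field K by fact
  interpret L: differential_field L by fact
  interpret ring_hom_cring K L h
    using diff_homD(1)[OF assms(3)] by unfold_locales
  show ?thesis
    using non_trivial_field_hom_is_inj[OF homh K.field_axioms L.field_axioms] .
qed

text \<open>Evaluation of differential polynomials commutes with differential homomorphisms.\<close>

lemma solvable_diff_hom:
  assumes K: "differential_field K" and L: "differential_field L" and h: "h \<in> diff_hom K L"
    and coeffs: "\<And>p. p \<in> E \<Longrightarrow> set_diff_poly p \<subseteq> carrier K" and "solvable K E"
  shows "solvable L (map_diff_poly h ` E)"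
proof -
  interpret K: differential_field K by fact
  obtain v where v: "v \<in> UNIV \<rightarrow> carrier K" "\<And>p. p \<in> E \<Longrightarrow> eval_diff_poly K v p = \<zero>\<^bsub>K\<^esub>"
    using \<open>solvable K E\<close> by (auto simp: solvable_def)
  have "eval_diff_poly K v p \<in> carrier K \<and>
      eval_diff_poly L (h \<circ> v) (map_diff_poly h p) = h (eval_diff_poly K v p)"
    if "set_diff_poly p \<subseteq> carrier K" for p
    using that v(1) by (induction p) (auto simp: diff_homD[OF h] Pi_iff)
  then have "eval_diff_poly L (h \<circ> v) (map_diff_poly h p) = \<zero>\<^bsub>L\<^esub>" if "p \<in> E" for p
    using that coeffs v(2) diff_hom_zero[OF K L h] by metis
  moreover have "h \<circ> v \<in> UNIV \<rightarrow> carrier L"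
    using v(1) diff_homD(2)[OF h] by (simp add: Pi_iff)
  ultimately show ?thesis
    by (auto simp: solvable_def)
qed

section \<open>Structures covered by differential fields\<close>

text \<open>
  Every law involves at most three elements, so that it can be pulled back along an embedding
  of some \<open>N\<close> whose image contains them. The image of the zero is prescribed because a
  \<^const>\<open>ring_hom\<close> need not preserve it as long as the target is not known to be a ring.
\<close>

lemma differential_field_directed:
  fixes M :: "'b diff_ring"
  assumes cover: "\<And>A. finite A \<Longrightarrow> A \<subseteq> carrier M \<Longrightarrow>
      \<exists>(N :: 'a diff_ring) h. differential_field N \<and> h \<in> diff_hom N M \<and> inj_on h (carrier N) \<and>
        h \<zero>\<^bsub>N\<^esub> = \<zero>\<^bsub>M\<^esub> \<and> A \<subseteq> h ` carrier N"
  shows "differential_field M"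
proof -
  have laws: "x \<oplus>\<^bsub>M\<^esub> y \<in> carrier M \<and> x \<otimes>\<^bsub>M\<^esub> y \<in> carrier M \<and>
      \<zero>\<^bsub>M\<^esub> \<in> carrier M \<and> \<one>\<^bsub>M\<^esub> \<in> carrier M \<and> \<zero>\<^bsub>M\<^esub> \<noteq> \<one>\<^bsub>M\<^esub> \<and>
      \<zero>\<^bsub>M\<^esub> \<oplus>\<^bsub>M\<^esub> x = x \<and> \<one>\<^bsub>M\<^esub> \<otimes>\<^bsub>M\<^esub> x = x \<and>
      x \<oplus>\<^bsub>M\<^esub> y = y \<oplus>\<^bsub>M\<^esub> x \<and> x \<otimes>\<^bsub>M\<^esub> y = y \<otimes>\<^bsub>M\<^esub> x \<and>
      x \<oplus>\<^bsub>M\<^esub> y \<oplus>\<^bsub>M\<^esub> z = x \<oplus>\<^bsub>M\<^esub> (y \<oplus>\<^bsub>M\<^esub> z) \<and>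
      x \<otimes>\<^bsub>M\<^esub> y \<otimes>\<^bsub>M\<^esub> z = x \<otimes>\<^bsub>M\<^esub> (y \<otimes>\<^bsub>M\<^esub> z) \<and>
      (x \<oplus>\<^bsub>M\<^esub> y) \<otimes>\<^bsub>M\<^esub> z = x \<otimes>\<^bsub>M\<^esub> z \<oplus>\<^bsub>M\<^esub> y \<otimes>\<^bsub>M\<^esub> z \<and>
      \<partial>x\<^bsub>M\<^esub> x \<in> carrier M \<and> \<partial>y\<^bsub>M\<^esub> x \<in> carrier M \<and>
      \<partial>x\<^bsub>M\<^esub> (x \<oplus>\<^bsub>M\<^esub> y) = \<partial>x\<^bsub>M\<^esub> x \<oplus>\<^bsub>M\<^esub> \<partial>x\<^bsub>M\<^esub> y \<and>
      \<partial>y\<^bsub>M\<^esub> (x \<oplus>\<^bsub>M\<^esub> y) = \<partial>y\<^bsub>M\<^esub> x \<oplus>\<^bsub>M\<^esub> \<partial>y\<^bsub>M\<^esub> y \<and>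
      \<partial>x\<^bsub>M\<^esub> (x \<otimes>\<^bsub>M\<^esub> y) = \<partial>x\<^bsub>M\<^esub> x \<otimes>\<^bsub>M\<^esub> y \<oplus>\<^bsub>M\<^esub> x \<otimes>\<^bsub>M\<^esub> \<partial>x\<^bsub>M\<^esub> y \<and>
      \<partial>y\<^bsub>M\<^esub> (x \<otimes>\<^bsub>M\<^esub> y) = \<partial>y\<^bsub>M\<^esub> x \<otimes>\<^bsub>M\<^esub> y \<oplus>\<^bsub>M\<^esub> x \<otimes>\<^bsub>M\<^esub> \<partial>y\<^bsub>M\<^esub> y \<and>
      \<partial>x\<^bsub>M\<^esub> (\<partial>y\<^bsub>M\<^esub> x) = \<partial>y\<^bsub>M\<^esub> (\<partial>x\<^bsub>M\<^esub> x)"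
    if M: "{x, y, z} \<subseteq> carrier M" for x y z
  proof -
    obtain N :: "'a diff_ring" and h x' y' z' where N: "differential_field N"
      and h: "h \<in> diff_hom N M" and inj: "inj_on h (carrier N)" and zero: "h \<zero>\<^bsub>N\<^esub> = \<zero>\<^bsub>M\<^esub>"
      and xyz: "x' \<in> carrier N" "y' \<in> carrier N" "z' \<in> carrier N" "x = h x'" "y = h y'" "z = h z'"
      using cover[OF _ M] by auto
    interpret N: differential_field N by fact
    have "h \<zero>\<^bsub>N\<^esub> \<noteq> h \<one>\<^bsub>N\<^esub>"
      using inj by (simp add: inj_on_eq_iff)
    \<comment> \<open>Each law for \<open>x\<close>, \<open>y\<close>, \<open>z\<close> is the image under \<open>h\<close> of the same law for \<open>x'\<close>, \<open>y'\<close>, \<open>z'\<close>.\<close>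
    then show ?thesis
      using xyz
      by (simp flip: diff_homD(3-7)[OF h] zero add: diff_homD(2)[OF h] N.a_ac N.m_ac N.l_distr N.r_distr
          N.pdx_add N.pdy_add N.pdx_mult N.pdy_mult N.derivations_commute)
  qed
  have inverses: "(\<exists>y\<in>carrier M. y \<oplus>\<^bsub>M\<^esub> x = \<zero>\<^bsub>M\<^esub>) \<and>
      (x \<noteq> \<zero>\<^bsub>M\<^esub> \<longrightarrow> (\<exists>y\<in>carrier M. x \<otimes>\<^bsub>M\<^esub> y = \<one>\<^bsub>M\<^esub>))" if M: "x \<in> carrier M" for x
  proof -
    obtain N :: "'a diff_ring" and h x' where N: "differential_field N"
      and h: "h \<in> diff_hom N M" and zero: "h \<zero>\<^bsub>N\<^esub> = \<zero>\<^bsub>M\<^esub>" and x: "x' \<in> carrier N" "x = h x'"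
      using cover[of "{x}"] M by auto
    interpret N: differential_field N by fact
    have "h (\<ominus>\<^bsub>N\<^esub> x') \<oplus>\<^bsub>M\<^esub> x = \<zero>\<^bsub>M\<^esub>"
      using x by (simp flip: diff_homD(4)[OF h] zero add: N.l_neg)
    moreover have "x \<otimes>\<^bsub>M\<^esub> h (inv\<^bsub>N\<^esub> x') = \<one>\<^bsub>M\<^esub> \<and> h (inv\<^bsub>N\<^esub> x') \<in> carrier M" if "x \<noteq> \<zero>\<^bsub>M\<^esub>"
    proof -
      have "x' \<in> Units N"
        using x zero that by (auto simp: N.field_Units)
      then show ?thesis
        using x by (simp flip: diff_homD(3,5)[OF h] add: diff_homD(2)[OF h])
    qed
    moreover have "h (\<ominus>\<^bsub>N\<^esub> x') \<in> carrier M"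
      using x diff_homD(2)[OF h] by simp
    ultimately show ?thesis
      by blast
  qed
  obtain N :: "'a diff_ring" and h where N: "differential_field N" and h: "h \<in> diff_hom N M"
    and inj: "inj_on h (carrier N)" and zero: "h \<zero>\<^bsub>N\<^esub> = \<zero>\<^bsub>M\<^esub>"
    using cover[of "{}"] by auto
  interpret N: differential_field N by fact
  have one_closed: "\<one>\<^bsub>M\<^esub> \<in> carrier M"
    using diff_homD(2,5)[OF h] by (metis N.one_closed)
  have "cring M"
  proof (rule cringI)
    show "abelian_group M"
      by (rule abelian_groupI) (use laws inverses one_closed in blast)+
    show "comm_monoid M"
      by (rule comm_monoidI) (use laws one_closed in blast)+
  qed (use laws in blast)
  then interpret M: cring M .
  have "field M"
    using laws[of "\<one>\<^bsub>M\<^esub>" "\<one>\<^bsub>M\<^esub>" "\<one>\<^bsub>M\<^esub>"] inverses by (intro M.cring_fieldI2) blast+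
  moreover have "[n] \<cdot>\<^bsub>M\<^esub> \<one>\<^bsub>M\<^esub> \<noteq> \<zero>\<^bsub>M\<^esub>" if "n > 0" for n :: nat
  proof -
    have "h ([n] \<cdot>\<^bsub>N\<^esub> \<one>\<^bsub>N\<^esub>) = [n] \<cdot>\<^bsub>M\<^esub> \<one>\<^bsub>M\<^esub>"
      by (induction n) (simp_all add: zero diff_homD(4,5)[OF h])
    then show ?thesis
      using N.char_zero[OF that] zero inj
      by (metis N.add.nat_pow_closed N.one_closed N.zero_closed inj_onD)
  qed
  moreover have "derivation M \<partial>x\<^bsub>M\<^esub>" "derivation M \<partial>y\<^bsub>M\<^esub>"
    unfolding derivation_def by (intro conjI ballI funcsetI; use laws in blast)+
  ultimately show ?thesis
    using laws by (intro differential_field.intro differential_field_axioms.intro) blast+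
qed

section \<open>Renaming elements\<close>

text \<open>The structure on \<open>g ` carrier K\<close> that makes an injection \<open>g\<close> an isomorphism.\<close>

definition transport :: "('a \<Rightarrow> 'b) \<Rightarrow> 'a diff_ring \<Rightarrow> 'b diff_ring"
  where "transport g K = (let r = inv_into (carrier K) g in
    \<lparr>carrier = g ` carrier K,
     mult = (\<lambda>a b. g (r a \<otimes>\<^bsub>K\<^esub> r b)),
     one = g \<one>\<^bsub>K\<^esub>,
     zero = g \<zero>\<^bsub>K\<^esub>,
     add = (\<lambda>a b. g (r a \<oplus>\<^bsub>K\<^esub> r b)),
     pdx = (\<lambda>a. g (\<partial>x\<^bsub>K\<^esub> (r a))),
     pdy = (\<lambda>a. g (\<partial>y\<^bsub>K\<^esub> (r a)))\<rparr>)"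

lemma transport_diff_hom:
  assumes "inj_on g (carrier K)"
  shows "g \<in> diff_hom K (transport g K)"
  using assms by (intro diff_homI) (simp_all add: transport_def Let_def)

lemma carrier_transport [simp]: "carrier (transport g K) = g ` carrier K"
  by (simp add: transport_def Let_def)

lemma transport_differential_field:
  assumes K: "differential_field K" and inj: "inj_on g (carrier K)"
  shows "differential_field (transport g K)"
proof (rule differential_field_directed)
  have "g \<zero>\<^bsub>K\<^esub> = \<zero>\<^bsub>transport g K\<^esub>"
    by (simp add: transport_def Let_def)
  then show "\<exists>(N :: 'a diff_ring) h. differential_field N \<and> h \<in> diff_hom N (transport g K) \<and>
      inj_on h (carrier N) \<and> h \<zero>\<^bsub>N\<^esub> = \<zero>\<^bsub>transport g K\<^esub> \<and> A \<subseteq> h ` carrier N"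
    if "A \<subseteq> carrier (transport g K)" for A
    using K inj transport_diff_hom[OF inj] that by (intro exI[of _ K] exI[of _ g]) simp
qed

section \<open>Unions of chains\<close>

text \<open>
  The operations of the members of an increasing chain agree where they are defined; the least member
  that contains the arguments serves as a representative.
\<close>

definition union_diff_ring :: "(nat \<Rightarrow> 'a diff_ring) \<Rightarrow> 'a diff_ring"
  where "union_diff_ring K = (let level = (\<lambda>A. LEAST n. A \<subseteq> carrier (K n)) in
    \<lparr>carrier = (\<Union>n. carrier (K n)),
     mult = (\<lambda>a b. a \<otimes>\<^bsub>K (level {a, b})\<^esub> b),
     one = \<one>\<^bsub>K 0\<^esub>,
     zero = \<zero>\<^bsub>K 0\<^esub>,
     add = (\<lambda>a b. a \<oplus>\<^bsub>K (level {a, b})\<^esub> b),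
     pdx = (\<lambda>a. \<partial>x\<^bsub>K (level {a})\<^esub> a),
     pdy = (\<lambda>a. \<partial>y\<^bsub>K (level {a})\<^esub> a)\<rparr>)"

lemma carrier_union_diff_ring [simp]:
  "carrier (union_diff_ring K) = (\<Union>n. carrier (K n))"
  by (simp add: union_diff_ring_def Let_def)

locale differential_field_chain =
  fixes K :: "nat \<Rightarrow> 'a diff_ring"
  assumes chain_field: "\<And>n. differential_field (K n)"
    and chain_step: "\<And>n. (\<lambda>a. a) \<in> diff_hom (K n) (K (Suc n))"
begin

lemma chain_diff_hom:
  assumes "n \<le> m"
  shows "(\<lambda>a. a) \<in> diff_hom (K n) (K m)"
  using assms
proof (induction m rule: dec_induct)
  case base
  show ?case
    by (rule diff_homI) simp_all
next
  case (step m)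
  show ?case
    using diff_hom_comp[OF step.IH chain_step[of m]]
    by (simp add: comp_def)
qed

lemma carrier_chain_mono: "n \<le> m \<Longrightarrow> carrier (K n) \<subseteq> carrier (K m)"
  by (rule subsetI) (rule diff_homD(2)[OF chain_diff_hom])

lemma finite_subset_chain:
  assumes "finite A" and "A \<subseteq> (\<Union>n. carrier (K n))"
  shows "\<exists>n. A \<subseteq> carrier (K n)"
  using assms
proof (induction A)
  case empty
  show ?case
    by simp
next
  case (insert a A)
  then obtain n m where "A \<subseteq> carrier (K n)" and "a \<in> carrier (K m)"
    by auto
  then have "insert a A \<subseteq> carrier (K (max n m))"
    using carrier_chain_mono[of n "max n m"] carrier_chain_mono[of m "max n m"] by auto
  then show ?case ..
qed

lemma union_diff_hom: "(\<lambda>a. a) \<in> diff_hom (K n) (union_diff_ring K)"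
proof -
  have level: "(LEAST m. A \<subseteq> carrier (K m)) \<le> n" "A \<subseteq> carrier (K (LEAST m. A \<subseteq> carrier (K m)))"
    if "A \<subseteq> carrier (K n)" for A
    using that by (rule Least_le) (use that in \<open>rule LeastI\<close>)
  show ?thesis
  proof (rule diff_homI)
    fix a b
    assume "a \<in> carrier (K n)" and "b \<in> carrier (K n)"
    then have *: "(LEAST m. {a, b} \<subseteq> carrier (K m)) \<le> n"
      "a \<in> carrier (K (LEAST m. {a, b} \<subseteq> carrier (K m)))"
      "b \<in> carrier (K (LEAST m. {a, b} \<subseteq> carrier (K m)))"
      using level[of "{a, b}"] by auto
    show "a \<otimes>\<^bsub>K n\<^esub> b = a \<otimes>\<^bsub>union_diff_ring K\<^esub> b"
      using diff_homD(3)[OF chain_diff_hom[OF *(1)] *(2,3)] by (simp add: union_diff_ring_def Let_def)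
    show "a \<oplus>\<^bsub>K n\<^esub> b = a \<oplus>\<^bsub>union_diff_ring K\<^esub> b"
      using diff_homD(4)[OF chain_diff_hom[OF *(1)] *(2,3)] by (simp add: union_diff_ring_def Let_def)
  next
    fix a
    assume "a \<in> carrier (K n)"
    then have *: "(LEAST m. {a} \<subseteq> carrier (K m)) \<le> n"
      "a \<in> carrier (K (LEAST m. {a} \<subseteq> carrier (K m)))"
      using level[of "{a}"] by auto
    show "\<partial>x\<^bsub>K n\<^esub> a = \<partial>x\<^bsub>union_diff_ring K\<^esub> a"
      using diff_homD(6)[OF chain_diff_hom[OF *(1)] *(2)] by (simp add: union_diff_ring_def Let_def)
    show "\<partial>y\<^bsub>K n\<^esub> a = \<partial>y\<^bsub>union_diff_ring K\<^esub> a"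
      using diff_homD(7)[OF chain_diff_hom[OF *(1)] *(2)] by (simp add: union_diff_ring_def Let_def)
  next
    show "\<one>\<^bsub>K n\<^esub> = \<one>\<^bsub>union_diff_ring K\<^esub>"
      using diff_homD(5)[OF chain_diff_hom[of 0 n]] by (simp add: union_diff_ring_def Let_def)
  qed auto
qed

lemma union_differential_field: "differential_field (union_diff_ring K)"
proof (rule differential_field_directed)
  fix A
  assume "finite A" and "A \<subseteq> carrier (union_diff_ring K)"
  then obtain n where "A \<subseteq> carrier (K n)"
    using finite_subset_chain[of A] unfolding carrier_union_diff_ring by blast
  moreover have "\<zero>\<^bsub>K n\<^esub> = \<zero>\<^bsub>union_diff_ring K\<^esub>"
    using diff_hom_zero[OF chain_field chain_field chain_diff_hom[of 0 n]] 
    by (simp add: union_diff_ring_def Let_def)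
  ultimately show "\<exists>(N :: 'a diff_ring) h. differential_field N \<and> h \<in> diff_hom N (union_diff_ring K) \<and>
      inj_on h (carrier N) \<and> h \<zero>\<^bsub>N\<^esub> = \<zero>\<^bsub>union_diff_ring K\<^esub> \<and> A \<subseteq> h ` carrier N"
    using chain_field[of n] union_diff_hom[of n] by (intro exI[of _ "K n"] exI[of _ "\<lambda>a. a"]) auto
qed

end

section \<open>A countable differentially closed field\<close>

definition rat_diff_ring :: "rat diff_ring"
  where "rat_diff_ring = \<lparr>carrier = UNIV, mult = (*), one = 1, zero = 0, add = (+),
    pdx = (\<lambda>_. 0), pdy = (\<lambda>_. 0)\<rparr>"

lemma rat_differential_field: "differential_field rat_diff_ring"
proof -
  have "cring rat_diff_ring"
  proof (rule cringI)
    show "abelian_group rat_diff_ring"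
    proof (rule abelian_groupI)
      show "\<exists>y\<in>carrier rat_diff_ring. y \<oplus>\<^bsub>rat_diff_ring\<^esub> x = \<zero>\<^bsub>rat_diff_ring\<^esub>" for x
        by (rule bexI[of _ "- x"]) (simp_all add: rat_diff_ring_def)
    qed (simp_all add: rat_diff_ring_def)
    show "comm_monoid rat_diff_ring"
      by (rule comm_monoidI) (simp_all add: rat_diff_ring_def)
  qed (simp add: rat_diff_ring_def algebra_simps)
  then interpret cring rat_diff_ring .
  have "field rat_diff_ring"
  proof (rule cring_fieldI2)
    show "\<exists>b\<in>carrier rat_diff_ring. a \<otimes>\<^bsub>rat_diff_ring\<^esub> b = \<one>\<^bsub>rat_diff_ring\<^esub>"
      if "a \<noteq> \<zero>\<^bsub>rat_diff_ring\<^esub>" for a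
      using that by (intro bexI[of _ "inverse a"]) (simp_all add: rat_diff_ring_def)
  qed (simp add: rat_diff_ring_def)
  moreover have "[n] \<cdot>\<^bsub>rat_diff_ring\<^esub> \<one>\<^bsub>rat_diff_ring\<^esub> = rat_of_nat n" for n :: nat
    by (induction n) (simp_all add: rat_diff_ring_def add_pow_def nat_pow_def)
  ultimately show ?thesis
    by (intro differential_field.intro differential_field_axioms.intro)
      (auto simp: rat_diff_ring_def derivation_def)
qed

text \<open>
  The elements that stage \<open>n\<close> adds to the field are pairs with first component \<open>n\<close>; this leaves
  room in the natural numbers for all later stages.
\<close>

abbreviation tagged_upto :: "nat \<Rightarrow> nat set"
  where "tagged_upto n \<equiv> {a. fst (prod_decode a) \<le> n}"

text \<open>
  An extension \<open>h : K \<rightarrow> L\<close> may be renamed so that \<open>h\<close> becomes an inclusion: elements of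
  the image of \<open>K\<close> get back their old names, and all others get fresh names with the tag \<open>n + 1\<close>.
\<close>

lemma extension_within_nat:
  fixes K L :: "nat diff_ring"
  assumes K: "differential_field K" and L: "differential_field L" and h: "h \<in> diff_hom K L"
    and tags: "carrier K \<subseteq> tagged_upto n"
  obtains K' g where "differential_field K'" and "(\<lambda>a. a) \<in> diff_hom K K'"
    and "carrier K' \<subseteq> tagged_upto (Suc n)"
    and "g \<in> diff_hom L K'" and "\<And>a. a \<in> carrier K \<Longrightarrow> g (h a) = a"
proof
  define g where "g b =
    (if b \<in> h ` carrier K then inv_into (carrier K) h b else prod_encode (Suc n, b))" for b
  have gh: "g (h a) = a" if "a \<in> carrier K" for a
    using that diff_hom_inj[OF K L h] by (simp add: g_def)
  have new: "g b \<notin> tagged_upto n" if "b \<notin> h ` carrier K" for b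
    using that by (simp add: g_def)
  have inj: "inj_on g (carrier L)"
  proof (rule inj_onI)
    fix b c
    assume eq: "g b = g c"
    have old: "g b \<in> tagged_upto n" if "b \<in> h ` carrier K" for b
      using that gh tags by auto
    consider "b \<in> h ` carrier K" "c \<in> h ` carrier K" | "b \<notin> h ` carrier K" "c \<notin> h ` carrier K"
      using eq old[of b] old[of c] new[of b] new[of c] by argo
    then show "b = c"
    proof cases
      case 1
      then show ?thesis
        using eq gh by auto
    next
      case 2
      then show ?thesis
        using eq by (simp add: g_def)
    qed
  qed
  show "differential_field (transport g L)"
    using L inj by (rule transport_differential_field)
  show "g \<in> diff_hom L (transport g L)"
    using inj by (rule transport_diff_hom)
  from diff_hom_comp[OF h this] show "(\<lambda>a. a) \<in> diff_hom K (transport g L)"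
    by (rule diff_hom_cong[OF K]) (simp add: gh)
  show "g (h a) = a" if "a \<in> carrier K" for a
    using that by (rule gh)
  have "g b \<in> tagged_upto (Suc n)" for b
  proof (cases "b \<in> h ` carrier K")
    case True
    then show ?thesis
      using gh tags by fastforce
  next
    case False
    then show ?thesis
      by (simp add: g_def)
  qed
  then show "carrier (transport g L) \<subseteq> tagged_upto (Suc n)"
    by auto
qed

definition solvable_in_extension :: "'a diff_ring \<Rightarrow> 'a diff_poly set \<Rightarrow> bool"
  where "solvable_in_extension K E \<longleftrightarrow> (\<exists>(L :: 'a diff_ring) h. differential_field L \<and>
    h \<in> diff_hom K L \<and> solvable L (map_diff_poly h ` E))"

lemma solve_in_extension:
  fixes K :: "nat diff_ring"
  assumes K: "differential_field K" and tags: "carrier K \<subseteq> tagged_upto n"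
  shows "\<exists>K'. (differential_field K' \<and> carrier K' \<subseteq> tagged_upto (Suc n)) \<and>
    (\<lambda>a. a) \<in> diff_hom K K' \<and>
    ((\<forall>p\<in>E. set_diff_poly p \<subseteq> carrier K) \<and> solvable_in_extension K E \<longrightarrow> solvable K' E)"
proof (cases "(\<forall>p\<in>E. set_diff_poly p \<subseteq> carrier K) \<and> solvable_in_extension K E")
  case False
  have "(\<lambda>a. a) \<in> diff_hom K K"
    by (rule diff_homI) simp_all
  moreover have "carrier K \<subseteq> tagged_upto (Suc n)"
    using tags by auto
  ultimately show ?thesis
    using False K by blast
next
  case True
  then obtain L :: "nat diff_ring" and h where L: "differential_field L" and h: "h \<in> diff_hom K L"
    and sol: "solvable L (map_diff_poly h ` E)"
    by (auto simp: solvable_in_extension_def)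
  obtain K' g where K': "differential_field K'" "(\<lambda>a. a) \<in> diff_hom K K'"
    "carrier K' \<subseteq> tagged_upto (Suc n)" and g: "g \<in> diff_hom L K'"
    and gh: "\<And>a. a \<in> carrier K \<Longrightarrow> g (h a) = a"
    using extension_within_nat[OF K L h tags] by blast
  have "set_diff_poly p \<subseteq> carrier L" if "p \<in> map_diff_poly h ` E" for p
    using that True diff_homD(2)[OF h] by (fastforce simp: diff_poly.set_map)
  then have "solvable K' (map_diff_poly g ` map_diff_poly h ` E)"
    using solvable_diff_hom[OF L K'(1) g] sol by blast
  moreover have "map_diff_poly g (map_diff_poly h p) = p" if "p \<in> E" for p
  proof -
    have "map_diff_poly (g \<circ> h) p = map_diff_poly id p"
      using that True gh by (intro diff_poly.map_cong) auto
    then show ?thesis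
      by (simp add: diff_poly.map_comp diff_poly.map_id)
  qed
  then have "map_diff_poly g ` map_diff_poly h ` E = E"
    by force
  ultimately show ?thesis
    using K' by auto
qed

lemma finite_set_diff_poly: "finite (set_diff_poly p)"
  by (induction p) auto

text \<open>
  The system treated at stage \<open>n\<close> depends only on the first component of \<open>n\<close> as a pair, so that each
  system is treated at arbitrarily late stages, in particular after its coefficients have appeared.
\<close>

theorem differentially_closed_field_exists: "\<exists>K :: nat diff_ring. differentially_closed K"
proof -
  define system :: "nat \<Rightarrow> nat diff_poly set"
    where "system n = set (from_nat (fst (prod_decode n)))" for n
  define base :: "nat diff_ring" where "base = transport (\<lambda>q. prod_encode (0, to_nat q)) rat_diff_ring"
  have "inj_on (\<lambda>q :: rat. prod_encode (0, to_nat q)) (carrier rat_diff_ring)"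
    by (simp add: inj_on_def)
  then have base: "differential_field base \<and> carrier base \<subseteq> tagged_upto 0"
    using transport_differential_field[OF rat_differential_field] by (auto simp: base_def)
  have "\<exists>K. \<forall>n. (differential_field (K n) \<and> carrier (K n) \<subseteq> tagged_upto n) \<and>
      (\<lambda>a. a) \<in> diff_hom (K n) (K (Suc n)) \<and>
      ((\<forall>p\<in>system n. set_diff_poly p \<subseteq> carrier (K n)) \<and> solvable_in_extension (K n) (system n) \<longrightarrow>
        solvable (K (Suc n)) (system n))"
  proof (rule dependent_nat_choice)
    show "\<exists>K. differential_field K \<and> carrier K \<subseteq> tagged_upto 0"
      using base by blast
    show "\<exists>K'. (differential_field K' \<and> carrier K' \<subseteq> tagged_upto (Suc n)) \<and>
        (\<lambda>a. a) \<in> diff_hom K K' \<and>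
        ((\<forall>p\<in>system n. set_diff_poly p \<subseteq> carrier K) \<and> solvable_in_extension K (system n) \<longrightarrow>
          solvable K' (system n))"
      if "differential_field K \<and> carrier K \<subseteq> tagged_upto n" for K n
      using solve_in_extension[of K n "system n"] that by simp
  qed
  then obtain K where K: "\<And>n. differential_field (K n)"
    and step: "\<And>n. (\<lambda>a. a) \<in> diff_hom (K n) (K (Suc n))"
    and solved: "\<And>n. (\<forall>p\<in>system n. set_diff_poly p \<subseteq> carrier (K n)) \<Longrightarrow>
      solvable_in_extension (K n) (system n) \<Longrightarrow> solvable (K (Suc n)) (system n)"
    by auto
  let ?U = "union_diff_ring K"
  interpret chain: differential_field_chain K
    by (rule differential_field_chain.intro) (fact K step)+
  note U = chain.union_differential_field
  have "solvable ?U E" if "finite E" and coeffs: "\<forall>p\<in>E. set_diff_poly p \<subseteq> carrier ?U"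
    and L: "differential_field L" "h \<in> diff_hom ?U L" "solvable L (map_diff_poly h ` E)"
    for E and L :: "nat diff_ring" and h
  proof -
    have "finite (\<Union>p\<in>E. set_diff_poly p)"
      using \<open>finite E\<close> finite_set_diff_poly by auto
    moreover have "(\<Union>p\<in>E. set_diff_poly p) \<subseteq> (\<Union>n. carrier (K n))"
      using coeffs by auto
    ultimately obtain m where m: "(\<Union>p\<in>E. set_diff_poly p) \<subseteq> carrier (K m)"
      using chain.finite_subset_chain by blast
    obtain ps where ps: "set ps = E"
      using \<open>finite E\<close> finite_list by blast
    \<comment> \<open>A stage that treats \<open>E\<close>, late enough for the coefficients to be there already.\<close>
    define n where "n = prod_encode (to_nat ps, m)"
    have "system n = E"
      by (simp add: system_def n_def ps)
    have "m \<le> n"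
      by (simp add: n_def le_prod_encode_2)
    then have coeffs_n: "set_diff_poly p \<subseteq> carrier (K n)" if "p \<in> E" for p
      using m that chain.carrier_chain_mono by blast
    have "h \<in> diff_hom (K n) L"
      using diff_hom_comp[OF chain.union_diff_hom L(2)] by (simp add: comp_def)
    then have "solvable_in_extension (K n) E"
      using L by (auto simp: solvable_in_extension_def)
    then have "solvable (K (Suc n)) E"
      using solved[of n] coeffs_n \<open>system n = E\<close> by auto
    moreover have "set_diff_poly p \<subseteq> carrier (K (Suc n))" if "p \<in> E" for p
      using coeffs_n[OF that] chain.carrier_chain_mono[of n "Suc n"] by auto
    ultimately have "solvable ?U (map_diff_poly (\<lambda>a. a) ` E)"
      using solvable_diff_hom[OF K U chain.union_diff_hom] by blast
    then show ?thesis
      by (simp add: diff_poly.map_ident)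
  qed
  then have "differentially_closed ?U"
    using U unfolding differentially_closed_def by blast
  then show ?thesis ..
qed

section \<open>Monomial operators\<close>

text \<open>\<open>D\<^sub>x\<^sup>i D\<^sub>y\<^sup>j\<close> as an operator, \<open>X\<^sup>i Y\<^sup>j\<close> as a polynomial: normal forms do not distinguish them.\<close>

definition monomial :: "('a, 'm) ring_scheme \<Rightarrow> nat \<Rightarrow> nat \<Rightarrow> nat \<Rightarrow> nat \<Rightarrow> 'a"
  where "monomial K i j = (\<lambda>m n. if m = i \<and> n = j then \<one>\<^bsub>K\<^esub> else \<zero>\<^bsub>K\<^esub>)"

lemma carrier_poly_XY_iff:
  "F \<in> carrier (poly_XY K) \<longleftrightarrow>
    (\<forall>i j. F i j \<in> carrier K) \<and> finite {(i, j). F i j \<noteq> \<zero>\<^bsub>K\<^esub>}" (is "_ \<longleftrightarrow> ?coeffs \<and> finite ?S")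
proof
  assume "F \<in> carrier (poly_XY K)"
  then have F: "F \<in> up (UP K)"
    by (simp add: UP_def[of "UP K"])
  then have row: "F i \<in> up K" for i
    by (auto simp: UP_def dest: mem_upD)
  obtain n where n: "bound \<zero>\<^bsub>UP K\<^esub> n F"
    using F by (auto simp: up_def)
  have "finite {j. F i j \<noteq> \<zero>\<^bsub>K\<^esub>}" for i
  proof -
    obtain m where "bound \<zero>\<^bsub>K\<^esub> m (F i)"
      using row[of i] by (auto simp: up_def)
    then have "{j. F i j \<noteq> \<zero>\<^bsub>K\<^esub>} \<subseteq> {..m}"
      using bound_below by fastforce
    then show ?thesis
      by (rule finite_subset) simp
  qed
  moreover have "?S \<subseteq> (SIGMA i:{..n}. {j. F i j \<noteq> \<zero>\<^bsub>K\<^esub>})"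
  proof clarsimp
    fix i j
    assume "F i j \<noteq> \<zero>\<^bsub>K\<^esub>"
    then have "F i \<noteq> \<zero>\<^bsub>UP K\<^esub>"
      by (auto simp: UP_def)
    with n show "i \<le> n"
      by (rule bound_below)
  qed
  ultimately have "finite ?S"
    by (meson finite_SigmaI finite_atMost finite_subset)
  then show "?coeffs \<and> finite ?S"
    using row mem_upD by metis
next
  assume F: "?coeffs \<and> finite ?S"
  define n where "n = Max (insert 0 (fst ` ?S \<union> snd ` ?S))"
  have n: "i \<le> n \<and> j \<le> n" if "F i j \<noteq> \<zero>\<^bsub>K\<^esub>" for i j
  proof -
    have "i \<in> fst ` ?S" "j \<in> snd ` ?S"
      using that by force+
    then show ?thesis
      using F by (auto simp: n_def intro!: Max_ge)
  qed
  have "F i \<in> up K" for i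
    using F n by (intro mem_upI exI[of _ n] bound.intro) (auto simp: not_less[symmetric])
  moreover have "bound \<zero>\<^bsub>UP K\<^esub> n F"
    using n by (intro bound.intro) (auto simp: UP_def fun_eq_iff not_less[symmetric])
  ultimately show "F \<in> carrier (poly_XY K)"
    by (auto simp: UP_def up_def)
qed

lemma carrier_LPDO [simp]: "carrier (LPDO K) = carrier (poly_XY K)"
  and mult_LPDO [simp]: "mult (LPDO K) = lpdo_comp K"
  by (simp_all add: LPDO_def)

context differential_field
begin

lemma monomial_closed: "monomial K i j \<in> carrier (poly_XY K)"
proof -
  have "{(m, n). monomial K i j m n \<noteq> \<zero>} \<subseteq> {(i, j)}"
    by (auto simp: monomial_def)
  then have "finite {(m, n). monomial K i j m n \<noteq> \<zero>}"
    by (rule finite_subset) simp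
  then show ?thesis
    by (simp add: carrier_poly_XY_iff monomial_def)
qed

lemma order_monomial: "lpdo_order K (monomial K i j) = i + j"
  unfolding lpdo_order_def by (rule Least_equality) (auto simp: monomial_def)

lemma Sym_monomial: "Sym K (monomial K i j) = monomial K i j"
  unfolding Sym_def order_monomial by (auto simp: monomial_def fun_eq_iff)

lemma homogeneous_monomial: "homogeneous K (i + j) (monomial K i j)"
proof -
  have "monomial K i j i j \<noteq> \<zero>\<^bsub>poly_XY K\<^esub> i j"
    by (simp add: monomial_def UP_def)
  then have "monomial K i j \<noteq> \<zero>\<^bsub>poly_XY K\<^esub>"
    by force
  then show ?thesis
    using monomial_closed by (auto simp: homogeneous_def monomial_def)
qed

text \<open>
  The coefficients \<open>0\<close> and \<open>1\<close> of a monomial are constants, so the terms with \<open>\<partial>\<^sub>x\<close> and \<open>\<partial>\<^sub>y\<close>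
  vanish.
\<close>

lemma Dx_comp_monomial: "(Dx_comp K ^^ k) (monomial K i j) = monomial K (k + i) j"
  and Dy_comp_monomial: "(Dy_comp K ^^ k) (monomial K i j) = monomial K i (k + j)"
  by (induction k) (auto simp: Dx_comp_def Dy_comp_def monomial_def fun_eq_iff)

lemma comp_left_monomial:
  assumes "\<And>m n. (Dx_comp K ^^ i) ((Dy_comp K ^^ j) G) m n \<in> carrier K"
  shows "lpdo_comp K (monomial K i j) G = (Dx_comp K ^^ i) ((Dy_comp K ^^ j) G)"
proof -
  have "{(m, n). monomial K i j m n \<noteq> \<zero>} = {(i, j)}"
    by (auto simp: monomial_def)
  then show ?thesis
    using assms by (simp add: lpdo_comp_def monomial_def)
qed

lemma comp_monomial:
  "lpdo_comp K (monomial K i j) (monomial K k l) = monomial K (i + k) (j + l)"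
  using comp_left_monomial[of i j "monomial K k l"] monomial_closed
  by (simp add: Dx_comp_monomial Dy_comp_monomial carrier_poly_XY_iff)

lemma Dx_comp_closed:
  assumes "G \<in> carrier (poly_XY K)"
  shows "Dx_comp K G \<in> carrier (poly_XY K)"
proof -
  let ?S = "{(i, j). G i j \<noteq> \<zero>}"
  have coeffs: "G i j \<in> carrier K" for i j
    using assms by (simp add: carrier_poly_XY_iff)
  have fin: "finite ?S"
    using assms by (simp add: carrier_poly_XY_iff)
  have "G i j \<noteq> \<zero> \<or> (\<exists>k. i = Suc k \<and> G k j \<noteq> \<zero>)" if "Dx_comp K G i j \<noteq> \<zero>" for i j
    using that by (cases i) (auto simp: Dx_comp_def)
  then have "{(i, j). Dx_comp K G i j \<noteq> \<zero>} \<subseteq> ?S \<union> (\<lambda>(i, j). (Suc i, j)) ` ?S"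
    by force
  then have "finite {(i, j). Dx_comp K G i j \<noteq> \<zero>}"
    by (rule finite_subset) (simp add: fin)
  then show ?thesis
    using coeffs by (simp add: carrier_poly_XY_iff Dx_comp_def)
qed

text \<open>In normal form the derivations stand on the right, so that multiplying by \<open>D\<^sub>x\<close> from the right
  only shifts the coefficients.\<close>

lemma comp_Dx_right:
  assumes "H \<in> carrier (poly_XY K)"
  shows "lpdo_comp K H (monomial K 1 0) (Suc m) n = H m n"
proof -
  let ?S = "{(i, j). H i j \<noteq> \<zero>}"
  have coeffs: "H i j \<in> carrier K" for i j
    using assms by (simp add: carrier_poly_XY_iff)
  have fin: "finite ?S"
    using assms by (simp add: carrier_poly_XY_iff)
  have "lpdo_comp K H (monomial K 1 0) (Suc m) n =
      (\<Oplus>z\<in>?S. if (m, n) = z then case z of (i, j) \<Rightarrow> H i j else \<zero>)"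
    unfolding lpdo_comp_def Dx_comp_monomial Dy_comp_monomial
    by (rule add.finprod_cong') (auto simp: monomial_def coeffs split: if_splits)
  also have "\<dots> = H m n"
  proof (cases "H m n = \<zero>")
    case True
    then have "(\<Oplus>z\<in>?S. if (m, n) = z then case z of (i, j) \<Rightarrow> H i j else \<zero>) = (\<Oplus>z\<in>?S. \<zero>)"
      by (intro add.finprod_cong') auto
    then show ?thesis
      using True by simp
  next
    case False
    then show ?thesis
      using add.finprod_singleton[of "(m, n)" ?S "\<lambda>(i, j). H i j"] coeffs fin
      by (auto simp: Pi_iff)
  qed
  finally show ?thesis .
qed

section \<open>The counterexample\<close>

text \<open>
  Comparing coefficients at \<open>D\<^sub>x\<^bsup>m+2\<^esup> D\<^sub>y\<^sup>n\<close> expresses the coefficient of \<open>T\<close> at \<open>D\<^sub>x\<^sup>m D\<^sub>y\<^sup>n\<close> by the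
  negated derivative of the one at \<open>D\<^sub>x\<^bsup>m+1\<^esup> D\<^sub>y\<^sup>n\<close>. As \<open>T\<close> is finite, descending from large \<open>m\<close> kills all
  of them; but then the coefficient of the product at \<open>D\<^sub>x D\<^sub>y\<^sup>n\<close> vanishes, too.
\<close>

lemma not_between_Dx:
  assumes T: "T \<in> carrier (poly_XY K)"
  shows "monomial K 1 n \<noteq> lpdo_comp K (lpdo_comp K (monomial K 1 0) T) (monomial K 1 0)"
proof
  assume eq: "monomial K 1 n = lpdo_comp K (lpdo_comp K (monomial K 1 0) T) (monomial K 1 0)"
  have coeffs: "T i j \<in> carrier K" for i j
    using T by (simp add: carrier_poly_XY_iff)
  have fin: "finite {(i, j). T i j \<noteq> \<zero>}"
    using T by (simp add: carrier_poly_XY_iff)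
  have "lpdo_comp K (monomial K 1 0) T = Dx_comp K T"
    using comp_left_monomial[of 1 0 T] Dx_comp_closed[OF T] by (simp add: carrier_poly_XY_iff)
  then have coeff: "monomial K 1 n (Suc m) n = Dx_comp K T m n" for m
    using eq comp_Dx_right[OF Dx_comp_closed[OF T], of m n] by simp
  obtain N where N: "\<And>m. T m n \<noteq> \<zero> \<Longrightarrow> m < N"
  proof -
    have "finite (fst ` {(i, j). T i j \<noteq> \<zero>})"
      using fin by simp
    then obtain N where N: "\<forall>m\<in>fst ` {(i, j). T i j \<noteq> \<zero>}. m < N"
      using finite_nat_set_iff_bounded by blast
    then have "m < N" if "T m n \<noteq> \<zero>" for m
      using that by force
    then show ?thesis
      by (rule that)
  qed
  have "T m n = \<zero>" for m
  proof (cases "m \<le> N")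
    case True
    then show ?thesis
    proof (induction rule: inc_induct)
      case base
      show ?case
        using N by blast
    next
      case (step m)
      then show ?case
        using coeff[of "Suc m"] coeffs by (simp add: Dx_comp_def monomial_def)
    qed
  next
    case False
    then show ?thesis
      using N[of m] by linarith
  qed
  then show False
    using coeff[of 0] by (simp add: Dx_comp_def monomial_def)
qed

end

text \<open>The square of the indeterminate divides the product of two polynomials without constant term.\<close>

lemma (in cring) UP_mult_zero_constant_terms:
  assumes p: "p \<in> carrier (UP R)" "p 0 = \<zero>" and q: "q \<in> carrier (UP R)" "q 0 = \<zero>"
    and r: "r \<in> carrier (UP R)"
  shows "(p \<otimes>\<^bsub>UP R\<^esub> q \<otimes>\<^bsub>UP R\<^esub> r) 1 = \<zero>"
proof -
  interpret UP_cring R "UP R"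
    by (simp add: UP_cring_def cring_axioms)
  have coeff: "f n \<in> carrier R" if "f \<in> carrier (UP R)" for f n
    using that by (auto simp: UP_def)
  have "(f \<otimes>\<^bsub>UP R\<^esub> g) n = (\<Oplus>i\<in>{..n}. f i \<otimes> g (n - i))"
    if "f \<in> carrier (UP R)" "g \<in> carrier (UP R)" for f g n
    using that by (simp add: UP_def)
  then show ?thesis
    using p q r by (simp add: coeff)
qed

context differential_field
begin

text \<open>
  In \<open>K[Y][X]\<close>, both factors \<open>X\<close> have constant term \<open>0\<close>, so the product has no term linear in \<open>X\<close>.
\<close>

lemma X_squared_not_dvd:
  assumes "T \<in> carrier (poly_XY K)"
  shows "monomial K 1 n \<noteq> monomial K 1 0 \<otimes>\<^bsub>poly_XY K\<^esub> monomial K 1 0 \<otimes>\<^bsub>poly_XY K\<^esub> T"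
proof
  assume eq: "monomial K 1 n = monomial K 1 0 \<otimes>\<^bsub>poly_XY K\<^esub> monomial K 1 0 \<otimes>\<^bsub>poly_XY K\<^esub> T"
  interpret KY: UP_cring K "UP K"
    by (simp add: UP_cring_def is_cring)
  have "monomial K 1 0 0 = \<zero>\<^bsub>UP K\<^esub>"
    by (simp add: monomial_def UP_def)
  then have "monomial K 1 n 1 = \<zero>\<^bsub>UP K\<^esub>"
    using KY.P.UP_mult_zero_constant_terms[OF monomial_closed _ monomial_closed _ assms] eq by simp
  then have "monomial K 1 n 1 n = \<zero>"
    by (simp add: UP_def)
  then show False
    by (simp add: monomial_def)
qed

end

theorem proposition1:
  shows "(\<exists>K :: nat diff_ring. differentially_closed K \<and>
      \<not> (\<forall>S1 S2 L. homogeneous K 1 S1 \<and> homogeneous K 1 S2 \<and>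
            L \<in> carrier (LPDO K) \<and> lpdo_order K L = 3 \<longrightarrow>
          ((\<exists>F. lpdo_order K F = 1 \<and> Sym K F = S1 \<and> left_factor K F L) \<and>
           (\<exists>F. lpdo_order K F = 1 \<and> Sym K F = S2 \<and> right_factor K F L)
           \<longleftrightarrow>
           (\<exists>T \<in> carrier (poly_XY K).
              Sym K L = S1 \<otimes>\<^bsub>poly_XY K\<^esub> S2 \<otimes>\<^bsub>poly_XY K\<^esub> T \<and>
              has_factorization_of_type K L [S1, T, S2]))))
    \<and>
    (\<exists>K :: nat diff_ring. differentially_closed K \<and>
      \<not> (\<forall>F1 \<in> carrier (LPDO K). \<forall>F2 \<in> carrier (LPDO K). \<forall>L \<in> carrier (LPDO K).
            lpdo_order K F1 = 1 \<and> lpdo_order K F2 = 1 \<and> lpdo_order K L = 3 \<longrightarrow>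
          (left_factor K F1 L \<and> right_factor K F2 L
           \<longleftrightarrow>
           (\<exists>T \<in> carrier (LPDO K). L = F1 \<otimes>\<^bsub>LPDO K\<^esub> T \<otimes>\<^bsub>LPDO K\<^esub> F2))))"
proof -
  obtain K :: "nat diff_ring" where closed: "differentially_closed K"
    using differentially_closed_field_exists by blast
  then interpret differential_field K
    by (simp add: differentially_closed_def)
  let ?Dx = "monomial K 1 0" and ?L = "monomial K 1 2"
  have "left_factor K ?Dx ?L" and "right_factor K ?Dx ?L"
    unfolding left_factor_def right_factor_def
    using monomial_closed comp_monomial[of 1 0 0 2] comp_monomial[of 0 2 1 0]
    by (auto intro!: bexI[of _ "monomial K 0 2"] simp: numeral_2_eq_2)
  moreover have "lpdo_order K ?Dx = 1" and "lpdo_order K ?L = 3" and "homogeneous K 1 ?Dx"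
    using order_monomial[of 1 0] order_monomial[of 1 2] homogeneous_monomial[of 1 0] by simp_all
  moreover have "?L \<noteq> ?Dx \<otimes>\<^bsub>poly_XY K\<^esub> ?Dx \<otimes>\<^bsub>poly_XY K\<^esub> T"
    and "?L \<noteq> ?Dx \<otimes>\<^bsub>LPDO K\<^esub> T \<otimes>\<^bsub>LPDO K\<^esub> ?Dx" if "T \<in> carrier (poly_XY K)" for T
    using X_squared_not_dvd[OF that] not_between_Dx[OF that] by simp_all
  moreover have "?Dx \<in> carrier (LPDO K)" and "?L \<in> carrier (LPDO K)"
    and "Sym K ?Dx = ?Dx" and "Sym K ?L = ?L"
    using monomial_closed Sym_monomial by simp_all
  ultimately show ?thesis
    using closed unfolding carrier_LPDO by (intro conjI exI[of _ K]) metis+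
qed

end
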